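(* Let $n\geq1$ and $\tau$ be integers with $1\leq\tau<\lfloor n/2\rfloor$, and let $K_n$ be the complete graph on $n$ vertices. Then $\lceil\tau/10\rceil\leq \mathsf{c}^{\max}_{\tau}(K_n)\leq\tau$.
   Context: A multi-layer graph with designated layers is $(V,\{C_1,\dots,C_\tau\},R)$ with cop layers $C_i\subseteq\binom V2$ and robber layer $R\subseteq\binom V2$; $(V,\{C_1,\dots,C_\tau\},* )$ means $R=C_1\cup\dots\cup C_\tau$. Game with allocation $(k_1,\dots,k_\tau)$: $k_i$ cops assigned to layer $C_i$; cops placed first, then the robber; turns alternate starting with the cops; each cop stays or moves along one edge of its own layer, the robber stays or moves along one edge of $R$; cops win if a cop ever occupies the robber's vertex. The multi-layer cop number $\mathsf c(\mathcal G)$ is the least $k$ such that some allocation with $\sum_ik_i=k$ gives the cop player a winning strategy. For a connected simple graph $G=(V,E)$ and integer $\tau\geq1$, let $\mathcal{L}(G,\tau)$ be the set of all multi-layer graphs $(V,\{C_1,\dots,C_\tau\},* )$ with $C_1\cup\dots\cup C_\tau=E$ and each simple graph $(V,C_i)$ connected (layers may share edges). The extremal multi-layer cop number is $\mathsf{c}^{\max}_\tau(G)=\max_{\mathcal G\in\mathcal L(G,\tau)}\mathsf c(\mathcal G)$. *)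

theory Defs
  imports Complex_Main "HOL-Library.Ramsey"
begin

text \<open>Graphs on a vertex set \<open>V\<close> are given by their edge sets, i.e. by subsets of
  \<open>nsets V 2\<close>, the set of two-element subsets of \<open>V\<close>.\<close>

definition connected_graph :: "'a set \<Rightarrow> 'a set set \<Rightarrow> bool" where
  "connected_graph V E \<longleftrightarrow> V \<noteq> {} \<and> E \<subseteq> nsets V 2 \<and>
     (\<forall>u\<in>V. \<forall>v\<in>V. (u, v) \<in> {(x, y). {x, y} \<in> E}\<^sup>*)"

text \<open>The cop layers form an indexed family (a list), so two layers may coincide.\<close>

record 'a multilayer =
  verts :: "'a set"
  cop_layers :: "'a set set list"
  robber_layer :: "'a set set"

definition stay_or_move :: "'a set set \<Rightarrow> 'a \<Rightarrow> 'a \<Rightarrow> bool" where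
  "stay_or_move E x y \<longleftrightarrow> y = x \<or> {x, y} \<in> E"

text \<open>\<open>r t\<close> is the position of the robber after its \<open>t\<close>-th move; \<open>r 0\<close> is its initial position.\<close>

definition robber_play :: "'a multilayer \<Rightarrow> (nat \<Rightarrow> 'a) \<Rightarrow> bool" where
  "robber_play G r \<longleftrightarrow> r 0 \<in> verts G \<and> (\<forall>t. stay_or_move (robber_layer G) (r t) (r (Suc t)))"

text \<open>An allocation is a list \<open>ks\<close> with one entry per cop layer; the cops are the pairs
  \<open>(i, j)\<close> with \<open>j < ks ! i\<close>, cop \<open>(i, j)\<close> being assigned to layer \<open>i\<close>.\<close>

definition cops :: "nat list \<Rightarrow> (nat \<times> nat) set" where
  "cops ks = {(i, j). i < length ks \<and> j < ks ! i}"

text \<open>A cop strategy maps the list of robber positions seen so far, oldest first, to the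
  positions of all cops after responding to it. Thus \<open>s []\<close> is the initial placement, and
  \<open>s [r 0, \<dots>, r t]\<close> is the configuration after the cops' move number \<open>t + 1\<close>, made while the
  robber stands on \<open>r t\<close>. Past cop positions are determined by \<open>s\<close> and the robber's history,
  so this covers all history-dependent strategies.\<close>

type_synonym 'a cop_strategy = "'a list \<Rightarrow> nat \<times> nat \<Rightarrow> 'a"

definition legal_strategy :: "'a multilayer \<Rightarrow> nat list \<Rightarrow> 'a cop_strategy \<Rightarrow> bool" where
  "legal_strategy G ks s \<longleftrightarrow>
     (\<forall>c \<in> cops ks. s [] c \<in> verts G) \<and>
     (\<forall>r. robber_play G r \<longrightarrow> (\<forall>t. \<forall>c \<in> cops ks.
        stay_or_move (cop_layers G ! fst c) (s (map r [0..<t]) c) (s (map r [0..<Suc t]) c)))"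

text \<open>The robber is caught either when it stands on a cop just after its own \<open>t\<close>-th move (or
  initial placement), or when a cop moves onto \<open>r t\<close> in the subsequent cop move.\<close>

definition captures :: "nat list \<Rightarrow> 'a cop_strategy \<Rightarrow> (nat \<Rightarrow> 'a) \<Rightarrow> bool" where
  "captures ks s r \<longleftrightarrow>
     (\<exists>t. \<exists>c \<in> cops ks. s (map r [0..<t]) c = r t \<or> s (map r [0..<Suc t]) c = r t)"

definition cops_win :: "'a multilayer \<Rightarrow> nat list \<Rightarrow> bool" where
  "cops_win G ks \<longleftrightarrow>
     (\<exists>s. legal_strategy G ks s \<and> (\<forall>r. robber_play G r \<longrightarrow> captures ks s r))"

definition cop_number :: "'a multilayer \<Rightarrow> nat" where
  "cop_number G =
     (LEAST k. \<exists>ks. length ks = length (cop_layers G) \<and> sum_list ks = k \<and> cops_win G ks)"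

text \<open>The set of all \<open>(V, {C\<^sub>1, \<dots>, C\<^sub>\<tau>}, *)\<close> covering the graph \<open>(V, E)\<close> by connected layers,
  where \<open>*\<close> stands for the union of the cop layers.\<close>

definition layerings :: "'a set \<Rightarrow> 'a set set \<Rightarrow> nat \<Rightarrow> 'a multilayer set" where
  "layerings V E \<tau> =
     {\<lparr>verts = V, cop_layers = Cs, robber_layer = \<Union>(set Cs)\<rparr> | Cs.
        length Cs = \<tau> \<and> \<Union>(set Cs) = E \<and> (\<forall>C \<in> set Cs. connected_graph V C)}"

definition extremal_cop_number :: "'a set \<Rightarrow> 'a set set \<Rightarrow> nat \<Rightarrow> nat" where
  "extremal_cop_number V E \<tau> = Max (cop_number ` layerings V E \<tau>)"

end

theory Submission imports Defs "HOL-Number_Theory.Cong" begin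

text \<open>Upper bound: \<open>\<tau>\<close> cops, one per layer, start on a common vertex \<open>v\<close>; whatever vertex \<open>x\<close>
  the robber chooses, the edge \<open>vx\<close> lies in some layer, whose cop captures.

  Lower bound: on \<open>K\<^sub>n\<close> the robber can jump anywhere, so it escapes as soon as the closed
  neighbourhoods of the cops in their layers never cover \<open>V\<close>. Identify \<open>V\<close> with \<open>\<int>/n\<close> and
  partition the edges \<open>ab\<close> into \<open>n\<close> matchings according to \<open>a + b mod n\<close>. Two consecutive
  matchings \<open>s\<close>, \<open>s + 1\<close> form a connected graph, since \<open>a\<close>, \<open>s - a\<close>, \<open>a + 1\<close> is a walk in it.
  Dealing pairs of consecutive matchings in turn to the \<open>\<tau>\<close> layers gives connected layers of
  maximum degree at most \<open>n/\<tau> + 2\<close>, so fewer than \<open>\<tau>/10\<close> closed neighbourhoods miss a vertex.\<close>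

lemma doubleton_in_nsets_2 [simp]: "{x, y} \<in> nsets V 2 \<longleftrightarrow> x \<in> V \<and> y \<in> V \<and> x \<noteq> y"
  by (auto simp: nsets_2_eq doubleton_eq_iff)

lemma cops_eq_Sigma: "cops ks = Sigma {..<length ks} (\<lambda>i. {..<ks ! i})"
  by (auto simp: cops_def)

lemma finite_cops: "finite (cops ks)"
  by (simp add: cops_eq_Sigma)

lemma card_cops: "card (cops ks) = sum_list ks"
  by (simp add: cops_eq_Sigma sum_list_sum_nth atLeast0LessThan)

text \<open>Finiteness gives \<open>Max\<close> in \<open>extremal_cop_number\<close> its meaning as
  a largest element.\<close>

lemma finite_layerings:
  assumes "finite E"
  shows "finite (layerings V E \<tau>)"
proof (rule finite_subset)
  show "layerings V E \<tau> \<subseteq> (\<lambda>Cs. \<lparr>verts = V, cop_layers = Cs, robber_layer = \<Union>(set Cs)\<rparr>) `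
      {Cs. set Cs \<subseteq> Pow E \<and> length Cs = \<tau>}"
    unfolding layerings_def by blast
  show "finite \<dots>"
    using assms by (intro finite_imageI finite_lists_length_eq) auto
qed

lemma cops_win_one_per_layer:
  assumes V: "V \<noteq> {}" and "1 \<le> \<tau>" and G: "G \<in> layerings V (nsets V 2) \<tau>"
  shows "cops_win G (replicate \<tau> 1)"
proof -
  obtain v where v: "v \<in> V" using V by auto
  obtain Cs where Geq: "G = \<lparr>verts = V, cop_layers = Cs, robber_layer = \<Union>(set Cs)\<rparr>"
    and len: "length Cs = \<tau>" and un: "\<Union>(set Cs) = nsets V 2"
    using G unfolding layerings_def by blast
  \<comment> \<open>Only the robber's first position \<open>hd h\<close> matters: every cop whose
    layer contains the edge from \<open>v\<close> to it moves there at once and then rests. Legality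
    is therefore in question only at the first move.\<close>
  define s :: "'a cop_strategy" where
    "s = (\<lambda>h c. if h \<noteq> [] \<and> {v, hd h} \<in> Cs ! fst c then hd h else v)"
  have hd: "hd (map r [0..<Suc t]) = r 0" for r :: "nat \<Rightarrow> 'a" and t
    by (simp add: upt_conv_Cons del: upt_Suc)
  have cp: "(i, 0) \<in> cops (replicate \<tau> 1)" if "i < \<tau>" for i
    using that by (simp add: cops_def)
  have "legal_strategy G (replicate \<tau> 1) s"
    unfolding legal_strategy_def
  proof (intro conjI allI ballI impI)
    show "s [] c \<in> verts G" for c
      using v by (simp add: s_def Geq)
    show "stay_or_move (cop_layers G ! fst c) (s (map r [0..<t]) c) (s (map r [0..<Suc t]) c)"
      for r t c
    proof (cases t)
      case 0
      then show ?thesis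
        by (simp add: s_def stay_or_move_def Geq)
    next
      case (Suc m)
      then have "s (map r [0..<t]) c = s (map r [0..<Suc t]) c"
        unfolding Suc s_def hd by simp
      then show ?thesis by (simp add: stay_or_move_def)
    qed
  qed
  moreover have "captures (replicate \<tau> 1) s r" if "robber_play G r" for r
  proof (cases "r 0 = v")
    case True
    have "(0, 0) \<in> cops (replicate \<tau> 1)" "s (map r [0..<0]) (0, 0) = r 0"
      using \<open>1 \<le> \<tau>\<close> True cp[of 0] by (auto simp: s_def)
    then show ?thesis unfolding captures_def by blast
  next
    case False
    then have "{v, r 0} \<in> \<Union>(set Cs)"
      using that v unfolding un by (simp add: robber_play_def Geq)
    then obtain i where i: "i < \<tau>" "{v, r 0} \<in> Cs ! i"
      by (auto simp: in_set_conv_nth len)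
    have "(i, 0) \<in> cops (replicate \<tau> 1)" "s (map r [0..<Suc 0]) (i, 0) = r 0"
      using i cp[of i] by (auto simp: s_def)
    then show ?thesis unfolding captures_def by blast
  qed
  ultimately show ?thesis unfolding cops_win_def by blast
qed

text \<open>Before each cop move the robber jumps to a vertex outside all closed neighbourhoods of
  the current cop positions. Completeness makes every jump legal, and the next cop move cannot reach
  that vertex.\<close>

lemma robber_escapes:
  assumes complete: "nsets (verts G) 2 \<subseteq> robber_layer G"
    and uncovered: "\<And>p :: nat \<times> nat \<Rightarrow> 'a. \<exists>x \<in> verts G. \<forall>c \<in> cops ks.
      \<not> stay_or_move (cop_layers G ! fst c) (p c) x"
  shows "\<not> cops_win G ks"
proof
  assume "cops_win G ks"
  then obtain s where legal: "legal_strategy G ks s"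
    and win: "\<And>r. robber_play G r \<Longrightarrow> captures ks s r"
    unfolding cops_win_def by blast
  have "\<exists>f. \<forall>h. f h \<in> verts G \<and>
      (\<forall>c \<in> cops ks. \<not> stay_or_move (cop_layers G ! fst c) (s h c) (f h))"
    by (rule choice) (use uncovered in blast)
  then obtain f where fV: "\<And>h. f h \<in> verts G"
    and safe: "\<And>h c. c \<in> cops ks \<Longrightarrow> \<not> stay_or_move (cop_layers G ! fst c) (s h c) (f h)"
    by blast
  \<comment> \<open>Cop positions depend on the robber's history and the robber's answer on the cop
    positions; building the histories by recursion resolves this, with \<open>h t\<close> of length
    \<open>t\<close>.\<close>
  define h where "h = rec_nat [] (\<lambda>_ l. l @ [f l])"
  define r where "r = (\<lambda>t. f (h t))"
  have hist: "map r [0..<t] = h t" for t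
    by (induction t) (auto simp: h_def r_def)
  have play: "robber_play G r"
    unfolding robber_play_def stay_or_move_def r_def
    using fV complete by (metis doubleton_in_nsets_2 subsetD)
  then obtain t c where c: "c \<in> cops ks" and "s (h t) c = r t \<or> s (h (Suc t)) c = r t"
    using win[OF play] unfolding captures_def hist by blast
  moreover have "stay_or_move (cop_layers G ! fst c) (s (h t) c) (s (h (Suc t)) c)"
    using legal play c unfolding legal_strategy_def by (metis hist)
  \<comment> \<open>Both kinds of capture put \<open>r t\<close> in the closed neighbourhood of
    \<open>s (h t) c\<close>, which \<open>f\<close> avoids.\<close>
  ultimately have "stay_or_move (cop_layers G ! fst c) (s (h t) c) (r t)"
    by (auto simp: stay_or_move_def)
  then show False
    using safe[OF c] by (simp add: r_def)
qed

text \<open>With \<open>f\<close> numbering the vertices, \<open>div 2\<close> pairs the sums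
  \<open>2 * j\<close> and \<open>2 * j + 1\<close>, and \<open>mod \<tau>\<close> deals these pairs
  cyclically to the layers.\<close>

definition sum_layer :: "'a set \<Rightarrow> ('a \<Rightarrow> nat) \<Rightarrow> nat \<Rightarrow> nat \<Rightarrow> nat \<Rightarrow> 'a set set" where
  "sum_layer V f n \<tau> i =
     {{x, y} | x y. x \<in> V \<and> y \<in> V \<and> x \<noteq> y \<and> (f x + f y) mod n div 2 mod \<tau> = i}"

lemma doubleton_in_sum_layer:
  "{x, y} \<in> sum_layer V f n \<tau> i \<longleftrightarrow>
     x \<in> V \<and> y \<in> V \<and> x \<noteq> y \<and> (f x + f y) mod n div 2 mod \<tau> = i"
  unfolding sum_layer_def by (auto simp: doubleton_eq_iff add.commute)

lemma sum_layer_subset: "sum_layer V f n \<tau> i \<subseteq> nsets V 2"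
  unfolding sum_layer_def by auto

lemma Union_sum_layers:
  assumes "0 < \<tau>"
  shows "(\<Union>i<\<tau>. sum_layer V f n \<tau> i) = nsets V 2"
proof
  show "(\<Union>i<\<tau>. sum_layer V f n \<tau> i) \<subseteq> nsets V 2"
    using sum_layer_subset by blast
  show "nsets V 2 \<subseteq> (\<Union>i<\<tau>. sum_layer V f n \<tau> i)"
  proof
    fix e assume "e \<in> nsets V 2"
    then obtain x y where "e = {x, y}" "x \<in> V" "y \<in> V" "x \<noteq> y"
      by (auto simp: nsets_2_eq)
    then show "e \<in> (\<Union>i<\<tau>. sum_layer V f n \<tau> i)"
      using assms by (auto simp: doubleton_in_sum_layer)
  qed
qed

text \<open>The sums \<open>2 * i\<close> and \<open>2 * i + 1\<close> already suffice; both are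
  residues below \<open>n\<close> because \<open>2 * \<tau> \<le> n\<close>.\<close>

lemma connected_sum_layer:
  assumes bij: "bij_betw f V {..<n}" and i: "i < \<tau>" and n: "2 * \<tau> \<le> n"
  shows "connected_graph V (sum_layer V f n \<tau> i)"
proof -
  define E where "E = {(x, y). {x, y} \<in> sum_layer V f n \<tau> i}"
  define g where "g = inv_into V f"
  have gV: "g a \<in> V" and fg: "f (g a) = a" if "a < n" for a
    using that bij unfolding g_def
    by (auto simp: bij_betw_def intro!: inv_into_into f_inv_into_f)
  have gf: "g (f x) = x" and fn: "f x < n" if "x \<in> V" for x
    using that bij unfolding g_def by (auto simp: bij_betw_def)
  \<comment> \<open>Reachability instead of adjacency absorbs the case \<open>a = b\<close>, where
    the walk stands still.\<close>
  have edge: "(g a, g b) \<in> E\<^sup>*"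
    if "a < n" "b < n" "(a + b) mod n = 2 * i \<or> (a + b) mod n = 2 * i + 1" for a b
  proof (cases "a = b")
    case False
    then have "g a \<noteq> g b" using fg that by metis
    moreover have "(a + b) mod n div 2 mod \<tau> = i" using that(3) i by auto
    ultimately have "(g a, g b) \<in> E"
      using that gV fg by (simp add: E_def doubleton_in_sum_layer)
    then show ?thesis by blast
  qed simp
  have sym: "sym (E\<^sup>*)"
    by (rule sym_rtrancl) (auto simp: sym_def E_def insert_commute)
  have step: "(g a, g (Suc a)) \<in> E\<^sup>*" if "Suc a < n" for a
  proof -
    \<comment> \<open>This is the residue of \<open>2 * i - a\<close> modulo \<open>n\<close>,
      written without truncated subtraction.\<close>
    define b where "b = (if a \<le> 2 * i then 2 * i - a else n + 2 * i - a)"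
    have b: "b < n" using that i n by (auto simp: b_def)
    have "a + b = 2 * i \<or> a + b = n + 2 * i" using that by (auto simp: b_def)
    then have "a + b = 2 * i \<and> b + Suc a = 2 * i + 1
        \<or> a + b = n + 2 * i \<and> b + Suc a = n + (2 * i + 1)"
      by auto
    moreover have "2 * i + 1 < n" using i n by linarith
    ultimately have "(a + b) mod n = 2 * i" "(b + Suc a) mod n = 2 * i + 1"
      by (elim disjE; simp only: mod_add_self1; simp)+
    then have "(g a, g b) \<in> E\<^sup>*" "(g b, g (Suc a)) \<in> E\<^sup>*"
      using edge that b by auto
    then show ?thesis by (rule rtrancl_trans)
  qed
  have from0: "(g 0, g a) \<in> E\<^sup>*" if "a < n" for a
    using that by (induction a) (auto intro: rtrancl_trans step)
  have "(u, v) \<in> E\<^sup>*" if "u \<in> V" "v \<in> V" for u v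
    using from0[OF fn[OF that(1)]] from0[OF fn[OF that(2)]] sym that
    by (metis gf rtrancl_trans symD)
  moreover have "V \<noteq> {}" using gV[of 0] i n by auto
  ultimately show ?thesis
    using sum_layer_subset unfolding connected_graph_def E_def by blast
qed

text \<open>For fixed \<open>p\<close> the sum modulo \<open>n\<close> determines \<open>x\<close>,
  so it suffices to count the residues dealt to layer \<open>i\<close>: at most two for each of
  \<open>n div (2 * \<tau>) + 1\<close> rounds. The last unit is for \<open>p\<close>
  itself.\<close>

lemma card_sum_layer_nbhd:
  assumes bij: "bij_betw f V {..<n}" and \<tau>: "0 < \<tau>"
  shows "card {x \<in> V. stay_or_move (sum_layer V f n \<tau> i) p x} \<le> 2 * (n div (2 * \<tau>)) + 3"
proof -
  let ?N = "{x \<in> V. (f p + f x) mod n div 2 mod \<tau> = i}"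
  let ?S = "{s. s < n \<and> s div 2 mod \<tau> = i}"
  let ?q = "n div (2 * \<tau>)"
  have inj: "inj_on (\<lambda>x. (f p + f x) mod n) ?N"
  proof (rule inj_onI)
    fix x y assume xy: "x \<in> ?N" "y \<in> ?N" "(f p + f x) mod n = (f p + f y) mod n"
    have lt: "f x < n" "f y < n" using xy bij by (auto simp: bij_betw_def)
    have "f x mod n = f y mod n"
      using xy(3) cong_add_lcancel_nat[of "f p" "f x" "f y" n] by (simp add: cong_def)
    then have "f x = f y" using lt by simp
    then show "x = y" using xy bij by (auto simp: bij_betw_def inj_on_def)
  qed
  \<comment> \<open>Here \<open>j\<close> is the round of the dealing and \<open>b\<close> the
    parity of the sum.\<close>
  have S: "?S \<subseteq> (\<lambda>(j, b). 2 * (i + j * \<tau>) + b) ` ({..?q} \<times> {..<2})"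
  proof
    fix s assume s: "s \<in> ?S"
    have "s = 2 * (i + (s div 2 div \<tau>) * \<tau>) + s mod 2"
      using s mod_div_mult_eq[of "s div 2" \<tau>] by simp
    moreover have "s div 2 div \<tau> \<le> ?q"
      using s by (simp add: div_mult2_eq[symmetric] div_le_mono)
    ultimately show "s \<in> (\<lambda>(j, b). 2 * (i + j * \<tau>) + b) ` ({..?q} \<times> {..<2})"
      by (intro image_eqI[of _ _ "(s div 2 div \<tau>, s mod 2)"]) auto
  qed
  have "(f p + f x) mod n < n" if "x \<in> V" for x
  proof -
    have "f x < n" using that bij by (auto simp: bij_betw_def)
    then show ?thesis by simp
  qed
  then have "card ?N \<le> card ?S"
    by (intro card_inj_on_le[OF inj]) auto
  also have "\<dots> \<le> card ((\<lambda>(j, b). 2 * (i + j * \<tau>) + b) ` ({..?q} \<times> {..<2::nat}))"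
    by (intro card_mono S) auto
  also have "\<dots> \<le> card ({..?q} \<times> {..<2::nat})"
    by (intro card_image_le) auto
  finally have N: "card ?N \<le> 2 * ?q + 2" by simp
  have "finite V" using bij bij_betw_finite by blast
  then have "card {x \<in> V. stay_or_move (sum_layer V f n \<tau> i) p x} \<le> card (insert p ?N)"
    by (intro card_mono) (auto simp: stay_or_move_def doubleton_in_sum_layer)
  also have "\<dots> \<le> Suc (card ?N)" by (rule card_insert_le_m1) auto
  finally show ?thesis using N by simp
qed

lemma few_cops_lose_on_sum_layers:
  fixes \<tau> :: nat
  assumes bij: "bij_betw f V {..<n}" and \<tau>: "0 < \<tau>" and n: "2 * \<tau> \<le> n"
    and len: "length ks = \<tau>" and few: "10 * sum_list ks < \<tau>"
  defines "Cs \<equiv> map (sum_layer V f n \<tau>) [0..<\<tau>]"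
  shows "\<not> cops_win \<lparr>verts = V, cop_layers = Cs, robber_layer = \<Union>(set Cs)\<rparr> ks"
proof (rule robber_escapes)
  show "nsets (verts \<lparr>verts = V, cop_layers = Cs, robber_layer = \<Union>(set Cs)\<rparr>) 2
      \<subseteq> robber_layer \<lparr>verts = V, cop_layers = Cs, robber_layer = \<Union>(set Cs)\<rparr>"
    using Union_sum_layers[OF \<tau>, of V f n] by (simp add: Cs_def atLeast0LessThan)
next
  fix p :: "nat \<times> nat \<Rightarrow> 'a"
  let ?k = "sum_list ks" and ?q = "n div (2 * \<tau>)"
  let ?N = "\<lambda>c. {x \<in> V. stay_or_move (Cs ! fst c) (p c) x}"
  have "card (?N c) \<le> 2 * ?q + 3" if "c \<in> cops ks" for c
  proof -
    have "Cs ! fst c = sum_layer V f n \<tau> (fst c)"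
      using that len by (auto simp: cops_def Cs_def)
    then show ?thesis using card_sum_layer_nbhd[OF bij \<tau>] by simp
  qed
  then have "card (\<Union>c\<in>cops ks. ?N c) \<le> ?k * (2 * ?q + 3)"
    using card_UN_le[OF finite_cops, of ?N ks]
      sum_bounded_above[of "cops ks" "\<lambda>c. card (?N c)" "2 * ?q + 3"]
    by (simp add: card_cops)
  also have "\<dots> < n"
  proof -
    \<comment> \<open>Since \<open>2 * \<tau> * ?q \<le> n\<close> and
      \<open>2 * \<tau> \<le> n\<close>, ten times the union bound is at most
      \<open>5 * n / 2\<close>, well below \<open>10 * n\<close>.\<close>
    have "10 * ?k * (2 * ?q + 3) \<le> \<tau> * (2 * ?q + 3)"
      using few by (intro mult_right_mono) auto
    also have "\<dots> = 2 * \<tau> * ?q + 3 * \<tau>" by (simp add: algebra_simps)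
    also have "\<dots> \<le> n + 3 * \<tau>" by simp
    also have "\<dots> < 10 * n" using n \<tau> by linarith
    finally show ?thesis by simp
  qed
  also have "n = card V" using bij_betw_same_card[OF bij] by simp
  finally have "(\<Union>c\<in>cops ks. ?N c) \<noteq> V" by auto
  then show "\<exists>x\<in>verts \<lparr>verts = V, cop_layers = Cs, robber_layer = \<Union>(set Cs)\<rparr>. \<forall>c\<in>cops ks.
      \<not> stay_or_move (cop_layers \<lparr>verts = V, cop_layers = Cs, robber_layer = \<Union>(set Cs)\<rparr> ! fst c)
        (p c) x"
    by auto
qed

theorem theorem5p6:
  fixes V :: "'a set" and n \<tau> :: nat
  assumes "n \<ge> 1" and "1 \<le> \<tau>" and "\<tau> < n div 2"
    and "finite V" and "card V = n"
  shows "\<lceil>real \<tau> / 10\<rceil> \<le> int (extremal_cop_number V (nsets V 2) \<tau>)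
    \<and> extremal_cop_number V (nsets V 2) \<tau> \<le> \<tau>"
proof -
  let ?L = "layerings V (nsets V 2) \<tau>"
  have V: "V \<noteq> {}" and n: "2 * \<tau> \<le> n" using assms by auto
  have fin: "finite (cop_number ` ?L)"
    using assms by (intro finite_imageI finite_layerings finite_imp_finite_nsets)
  have all_win: "\<exists>ks. length ks = length (cop_layers G) \<and> sum_list ks = \<tau> \<and> cops_win G ks"
    if "G \<in> ?L" for G
    using cops_win_one_per_layer[OF V \<open>1 \<le> \<tau>\<close> that] that
    by (intro exI[of _ "replicate \<tau> 1"]) (auto simp: layerings_def sum_list_replicate)
  have upper: "cop_number G \<le> \<tau>" if "G \<in> ?L" for G
    unfolding cop_number_def by (rule Least_le) (rule all_win[OF that])
  obtain f where bij: "bij_betw f V {..<n}"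
    using assms ex_bij_betw_finite_nat[of V] by (auto simp: atLeast0LessThan)
  define Cs where "Cs = map (sum_layer V f n \<tau>) [0..<\<tau>]"
  define G where "G = \<lparr>verts = V, cop_layers = Cs, robber_layer = \<Union>(set Cs)\<rparr>"
  have "\<Union>(set Cs) = nsets V 2"
    using Union_sum_layers[of \<tau> V f n] \<open>1 \<le> \<tau>\<close> by (simp add: Cs_def atLeast0LessThan)
  moreover have "\<forall>C\<in>set Cs. connected_graph V C"
    using connected_sum_layer[OF bij _ n] by (auto simp: Cs_def)
  moreover have "length Cs = \<tau>" by (simp add: Cs_def)
  ultimately have G: "G \<in> ?L" unfolding G_def layerings_def by blast
  \<comment> \<open>By \<open>all_win\<close> the \<open>LEAST\<close> is attained, so some winning
    allocation uses exactly \<open>cop_number G\<close> cops.\<close>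
  obtain ks where ks: "length ks = \<tau>" "sum_list ks = cop_number G" "cops_win G ks"
    using LeastI[of "\<lambda>k. \<exists>ks. length ks = length (cop_layers G) \<and> sum_list ks = k \<and> cops_win G ks",
        OF all_win[OF G]]
    unfolding cop_number_def by (auto simp: G_def Cs_def)
  have "\<tau> \<le> 10 * cop_number G"
    using few_cops_lose_on_sum_layers[OF bij _ n ks(1)] ks \<open>1 \<le> \<tau>\<close>
    unfolding G_def Cs_def by fastforce
  also have "cop_number G \<le> extremal_cop_number V (nsets V 2) \<tau>"
    unfolding extremal_cop_number_def using fin G by (intro Max_ge) auto
  finally have "\<lceil>real \<tau> / 10\<rceil> \<le> int (extremal_cop_number V (nsets V 2) \<tau>)"
    by (simp add: ceiling_le_iff)
  moreover have "extremal_cop_number V (nsets V 2) \<tau> \<le> \<tau>"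
    unfolding extremal_cop_number_def using fin G upper by (subst Max_le_iff) auto
  ultimately show ?thesis by blast
qed

end
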